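(* Let $p>q\geq 1$ be integers. If a pce language $L$ (over a finite totally ordered alphabet) has an eventually periodic signature with a rhythm of directing parameter $(q,p)$, then the carry propagation $\mathsf{CP}_L$ exists and $$\mathsf{CP}_L=\frac{p}{p-q}.$$
   Context: $A=\{0,1,\ldots,r-1\}$ is a finite alphabet with its natural order, $A^*$ the set of words over $A$, $|w|$ the length of $w$. The radix order on $A^*$: $v$ is less than $w$ if $|v|<|w|$, or if $|v|=|w|$ and $v$ is lexicographically less than $w$. A language $L\subseteq A^*$ is a pce language if every prefix of a word of $L$ is in $L$ and every word of $L$ is a strict prefix of another word of $L$. Languages considered are infinite (for a pce language, this means non-empty). Enumerate $L$ in increasing radix order as $w_0,w_1,w_2,\ldots$; write $\mathrm{Succ}_L(w_i)=w_{i+1}$. For words $u,v$: if $|u|=|v|$, $\Delta(u,v)$ is $|u|$ minus the length of the longest common prefix of $u$ and $v$; if $|u|\neq|v|$, $\Delta(u,v)=\max(|u|,|v|)$. Set $\mathsf{cp}_L(i)=\Delta(w_i,w_{i+1})$. The carry propagation of $L$ is the (finite) limit, if it exists, $\mathsf{CP}_L=\lim_{N\to\infty}\frac1N\sum_{i=0}^{N-1}\mathsf{cp}_L(i)$. Signature. For a prefix-closed language $L$, the language tree has the words of $L$ as nodes, $\varepsilon$ as root, and the children of a node $w$ are the words $wa\in L$ with $a\in A$; the breadth-first traversal (children ordered by their last letter) enumerates the nodes as $w_0=\varepsilon,w_1,w_2,\ldots$. The associated i-tree is obtained by making the root in addition a child of itself. The signature of $L$ is the sequence $\mathbf{s}=s_0s_1s_2\cdots$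 of the degrees (numbers of children) of the nodes of the i-tree in breadth-first order; that is, $s_0=1+\mathrm{card}\{a\in A: a\in L\}$ and $s_i=\mathrm{card}\{a\in A: w_ia\in L\}$ for $i\ge 1$. A rhythm of directing parameter $(q,p)$ is a $q$-tuple $\mathbf{r}=(r_0,\ldots,r_{q-1})$ of non-negative integers with $\sum_{i=0}^{q-1}r_i=p$. The signature is eventually periodic with rhythm $\mathbf{r}$ if $\mathbf{s}=\mathbf{t}\,\mathbf{r}^{\omega}$ for some finite sequence $\mathbf{t}$ of non-negative integers (where $\mathbf{r}^\omega=\mathbf{r}\mathbf{r}\mathbf{r}\cdots$). *)

theory Defs
  imports Complex_Main "HOL-Library.Sublist"
begin

definition pce :: "'a list set \<Rightarrow> bool" where
  "pce L \<longleftrightarrow> (\<forall>w\<in>L. \<forall>v. prefix v w \<longrightarrow> v \<in> L) \<and> (\<forall>w\<in>L. \<exists>v\<in>L. strict_prefix w v)"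

definition radix :: "('a::linorder list \<times> 'a list) set" where
  "radix = lenlex {(a, b). a < b}"

text \<open>The increasing enumeration of a language. It exists and is unique for every infinite
  language over a finite alphabet, see \<open>radix_enum_works\<close> below; otherwise the value is
  unspecified.\<close>

definition radix_enum :: "'a::linorder list set \<Rightarrow> nat \<Rightarrow> 'a list" where
  "radix_enum L = (THE w. range w = L \<and> (\<forall>i j. i < j \<longrightarrow> (w i, w j) \<in> radix))"

definition \<Delta> :: "'a list \<Rightarrow> 'a list \<Rightarrow> nat" where
  "\<Delta> u v = (if length u = length v then length u - length (longest_common_prefix u v)
            else max (length u) (length v))"

definition cp :: "'a::linorder list set \<Rightarrow> nat \<Rightarrow> nat" where
  "cp L i = \<Delta> (radix_enum L i) (radix_enum L (Suc i))"

definition cp_mean :: "'a::linorder list set \<Rightarrow> nat \<Rightarrow> real" where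
  "cp_mean L N = (1 / real N) * (\<Sum>i<N. real (cp L i))"

text \<open>Meaningful only if \<^term>\<open>cp_mean L\<close> is convergent.\<close>

definition CP :: "'a::linorder list set \<Rightarrow> real" where
  "CP L = lim (cp_mean L)"

definition children :: "'a list set \<Rightarrow> 'a list \<Rightarrow> 'a list set" where
  "children L w = {w @ [a] | a. w @ [a] \<in> L}"

definition i_children :: "'a list set \<Rightarrow> 'a list \<Rightarrow> 'a list set" where
  "i_children L w = (if w = [] then insert [] (children L w) else children L w)"

text \<open>For a prefix-closed language, the breadth-first traversal of the language tree is the
  enumeration in radix order.\<close>

definition signature :: "'a::linorder list set \<Rightarrow> nat \<Rightarrow> nat" where
  "signature L i = card (i_children L (radix_enum L i))"

definition is_rhythm :: "nat \<Rightarrow> nat \<Rightarrow> nat list \<Rightarrow> bool" where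
  "is_rhythm q p r \<longleftrightarrow> length r = q \<and> sum_list r = p"

text \<open>The sequence \<open>s\<close> is \<open>t r r r \<dots>\<close> for some finite sequence \<open>t\<close>.\<close>

definition eventually_periodic_with :: "(nat \<Rightarrow> nat) \<Rightarrow> nat list \<Rightarrow> bool" where
  "eventually_periodic_with s r \<longleftrightarrow>
     (\<exists>t. (\<forall>i<length t. s i = t ! i) \<and> (\<forall>i. s (length t + i) = r ! (i mod length r)))"

lemma radix_irrefl: "(u, u) \<notin> radix"
  unfolding radix_def by (rule lenlex_irreflexive) auto

lemma radix_trans: "(u, v) \<in> radix \<Longrightarrow> (v, w) \<in> radix \<Longrightarrow> (u, w) \<in> radix"
  unfolding radix_def by (erule (1) lenlex_trans) (auto intro: transI)

lemma radix_total:
  fixes u v :: "'a::linorder list"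
  shows "u \<noteq> v \<Longrightarrow> (u, v) \<in> radix \<or> (v, u) \<in> radix"
proof -
  assume "u \<noteq> v"
  have "total {(a, b). (a::'a) < b}" by (auto simp: total_on_def)
  from total_lenlex[OF this] show ?thesis
    using \<open>u \<noteq> v\<close> unfolding radix_def total_on_def by blast
qed

lemma radix_length: "(u, v) \<in> radix \<Longrightarrow> length u \<le> length v"
  unfolding radix_def by (rule lenlex_length)

lemma radix_enum_works:
  fixes L :: "'a::linorder list set"
  assumes A: "finite A" "L \<subseteq> lists A" and L: "infinite L"
  shows "\<exists>!w :: nat \<Rightarrow> 'a list. range w = L \<and> (\<forall>i j. i < j \<longrightarrow> (w i, w j) \<in> radix)"
proof -
  define B where "B v = {u \<in> L. (u, v) \<in> radix}" for v
  have fB: "finite (B v)" for v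
  proof (rule finite_subset)
    show "B v \<subseteq> {u. set u \<subseteq> A \<and> length u \<le> length v}"
      using A(2) radix_length by (auto simp: B_def)
    show "finite {u. set u \<subseteq> A \<and> length u \<le> length v}"
      using A(1) by (rule finite_lists_length_le)
  qed
  define k where "k v = card (B v)" for v
  have mono: "k u < k v" if "u \<in> L" "(u, v) \<in> radix" for u v
    unfolding k_def
  proof (rule psubset_card_mono[OF fB])
    have "B u \<subseteq> B v" using that(2) radix_trans by (auto simp: B_def)
    moreover have "u \<in> B v" "u \<notin> B u" using that radix_irrefl by (auto simp: B_def)
    ultimately show "B u \<subset> B v" by blast
  qed
  have rank: "k (w i) = i"
    if w: "range w = L" "\<forall>i j. i < j \<longrightarrow> (w i, w j) \<in> radix" for w i
  proof -
    have "inj w"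
      by (rule injI) (metis w(2) radix_irrefl linorder_neqE_nat)
    moreover have "B (w i) = w ` {..<i}"
    proof
      show "w ` {..<i} \<subseteq> B (w i)" using w by (auto simp: B_def)
      show "B (w i) \<subseteq> w ` {..<i}"
      proof
        fix u assume u: "u \<in> B (w i)"
        then obtain j where j: "u = w j" using w(1) by (auto simp: B_def)
        have "j < i"
        proof (rule ccontr)
          assume "\<not> j < i"
          then consider "i = j" | "i < j" by linarith
          then have "i = j \<or> (w i, w j) \<in> radix" using w(2) by cases auto
          moreover have "(w j, w i) \<in> radix" using u j by (simp add: B_def)
          ultimately show False using radix_irrefl radix_trans by blast
        qed
        then show "u \<in> w ` {..<i}" using j by auto
      qed
    qed
    ultimately show ?thesis
      by (simp add: k_def card_image inj_on_subset[OF _ subset_UNIV])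
  qed
  have inj: "inj_on k L"
    by (rule inj_onI) (metis mono radix_total less_irrefl)
  have down: "\<exists>u\<in>L. k u = i" if "v \<in> L" "i < k v" for v i
  proof -
    have sub: "k ` B v \<subseteq> {..<k v}" using mono by (auto simp: B_def)
    have "card (k ` B v) = k v"
      unfolding k_def[of v] by (rule card_image) (rule inj_on_subset[OF inj], auto simp: B_def)
    then have "k ` B v = {..<k v}" using card_subset_eq[OF _ sub] by simp
    then have "i \<in> k ` B v" using that by auto
    then show ?thesis by (auto simp: B_def)
  qed
  have surj: "\<exists>u\<in>L. k u = i" for i
  proof -
    have "infinite (k ` L)" using L inj finite_imageD by blast
    then obtain m where "m \<in> k ` L" "i < m" by (meson finite_nat_set_iff_bounded_le not_le)
    then show ?thesis using down by blast
  qed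
  define w where "w i = the_inv_into L k i" for i
  have kw: "k (w i) = i" "w i \<in> L" for i
    using surj[of i] inj by (auto simp: w_def the_inv_into_f_f)
  have range_w: "range w = L"
  proof
    show "range w \<subseteq> L" using kw(2) by auto
    show "L \<subseteq> range w"
    proof
      fix v assume "v \<in> L"
      then have "w (k v) = v" by (intro inj_onD[OF inj] kw)
      then show "v \<in> range w" by (metis rangeI)
    qed
  qed
  have incr_w: "(w i, w j) \<in> radix" if "i < j" for i j
  proof (rule ccontr)
    assume "(w i, w j) \<notin> radix"
    moreover have "w i \<noteq> w j" using kw(1)[of i] kw(1)[of j] that by auto
    ultimately have "(w j, w i) \<in> radix" using radix_total by blast
    then have "k (w j) < k (w i)" using mono kw(2) by blast
    then show False using kw(1) that by simp
  qed
  have uniq_w: "w' = w" if "range w' = L \<and> (\<forall>i j. i < j \<longrightarrow> (w' i, w' j) \<in> radix)" for w'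
  proof
    fix i
    have "k (w' i) = k (w i)" using rank[of w' i] that kw(1)[of i] by simp
    moreover have "w' i \<in> L" using that by blast
    ultimately show "w' i = w i" using inj_onD[OF inj _ _ kw(2)] by simp
  qed
  show ?thesis
  proof (rule ex1I)
    show "range w = L \<and> (\<forall>i j. i < j \<longrightarrow> (w i, w j) \<in> radix)"
      using range_w incr_w by simp
  qed (rule uniq_w)
qed

end

theory Submission
  imports Defs
begin

text \<open>
  In the i-tree of \<open>L\<close> the parent of a word \<open>w\<close> is \<^term>\<open>butlast w\<close>; the convention
  \<^term>\<open>butlast [] = []\<close> is exactly the loop at the root. Two facts about this parent map
  carry the proof.

  Locally, \<open>\<Delta>\<close> drops by exactly one from a pair of distinct words to the pair of their parents
  (\<open>Delta_butlast\<close>), whether or not the two words have the same length, and whether or not their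
  parents coincide. Read on indices, the parent map \<open>f\<close> is monotone and, as every word of \<open>L\<close> has
  a child, onto; so it moves by at most one from \<open>j\<close> to \<open>j + 1\<close>, and
  \<open>cp j\<close> is \<open>1\<close> if it stays and \<open>1 + cp (f j)\<close> if it moves. As it moves away from each index
  only once, the partial sums \<open>F N\<close> of \<open>cp\<close> satisfy \<open>F N = N + F (f N)\<close>.

  Globally, the fibres of \<open>f\<close> have the cardinalities given by the signature, so \<open>f N\<close> is found by
  inverting the partial sums \<open>S\<close> of the signature: \<open>S (f N) \<le> N < S (f N + 1)\<close>. Eventual
  periodicity makes \<open>S n - (p / q) n\<close> bounded, hence \<open>f N = (q / p) N + O(1)\<close>.

  Finally, a sequence with \<open>F N = N + F (\<alpha> N + O(1))\<close>, where \<open>0 \<le> \<alpha> < 1\<close>, grows like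
  \<open>(1 + \<alpha> + \<alpha>\<^sup>2 + \<dots>) N\<close> (\<open>contracting_recursion_limit\<close>), and \<open>\<alpha> = q / p\<close> gives
  \<open>p / (p - q)\<close>.
\<close>

section \<open>A contracting recursion\<close>

text \<open>
  The difference \<open>G N = F N - c N\<close> with \<open>c = 1 / (1 - \<alpha>)\<close> changes only by a bounded amount from
  \<open>M N\<close> to \<open>N\<close>, because \<open>c\<close> solves \<open>c = 1 + \<alpha> c\<close>. A bounded gain per step is beaten by any
  positive slope \<open>\<epsilon>\<close> as soon as a step shortens \<open>N\<close> by a large amount, whence
  \<open>\<bar>G N\<bar> \<le> \<epsilon> N + D\<close>.
\<close>

lemma contracting_recursion_limit:
  fixes F :: "nat \<Rightarrow> real" and M :: "nat \<Rightarrow> nat" and \<alpha> B :: real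
  assumes \<alpha>: "0 \<le> \<alpha>" "\<alpha> < 1"
    and M: "\<And>N. \<bar>real (M N) - \<alpha> * real N\<bar> \<le> B"
    and F: "\<And>N. F N = real N + F (M N)"
  shows "(\<lambda>N. F N / real N) \<longlonglongrightarrow> 1 / (1 - \<alpha>)"
proof -
  define c where "c = 1 / (1 - \<alpha>)"
  define G where "G N = F N - c * real N" for N
  define K where "K = c * B"
  have c0: "c > 0" using \<alpha> by (simp add: c_def)
  have B0: "B \<ge> 0" using M[of 0] by linarith
  have c_eq: "c = 1 + \<alpha> * c" using \<alpha> by (simp add: c_def field_simps)
  have step: "\<bar>G N\<bar> \<le> \<bar>G (M N)\<bar> + K" for N
  proof -
    have "c * real N = (1 + \<alpha> * c) * real N" using c_eq by simp
    then have "G N = G (M N) + c * (real (M N) - \<alpha> * real N)"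
      using F[of N] by (simp add: G_def algebra_simps)
    moreover have "\<bar>c * (real (M N) - \<alpha> * real N)\<bar> \<le> K"
      unfolding K_def abs_mult using M[of N] c0 by (simp add: mult_left_mono)
    ultimately show ?thesis by linarith
  qed
  have bound: "\<exists>D. \<forall>N. \<bar>G N\<bar> \<le> \<epsilon> * real N + D" if "\<epsilon> > 0" for \<epsilon>
  proof -
    (* Beyond N0 a step shortens N so much that the slope pays for the gain K. *)
    obtain N0 :: nat where N0: "(\<epsilon> * B + K + \<epsilon>) / (\<epsilon> * (1 - \<alpha>)) \<le> real N0"
      using real_arch_simple by blast
    define D where "D = Max ((\<lambda>N. \<bar>G N\<bar>) ` {..N0})"
    have "\<bar>G N\<bar> \<le> \<epsilon> * real N + D" for N
    proof (induction N rule: less_induct)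
      case (less N)
      show ?case
      proof (cases "N \<le> N0")
        case True
        then have "\<bar>G N\<bar> \<le> D" unfolding D_def by (intro Max_ge) auto
        then show ?thesis using \<open>\<epsilon> > 0\<close> by (simp add: add_increasing)
      next
        case False
        have pos: "\<epsilon> * (1 - \<alpha>) > 0" using \<open>\<epsilon> > 0\<close> \<alpha> by simp
        have "\<epsilon> * B + K + \<epsilon> \<le> real N0 * (\<epsilon> * (1 - \<alpha>))"
          using N0 pos by (simp add: pos_divide_le_eq)
        also have "\<dots> \<le> real N * (\<epsilon> * (1 - \<alpha>))"
          using False pos by (intro mult_right_mono) auto
        finally have big: "\<epsilon> * (\<alpha> * real N + B) + K + \<epsilon> \<le> \<epsilon> * real N"
          by (simp add: algebra_simps)
        have MN: "\<epsilon> * real (M N) \<le> \<epsilon> * (\<alpha> * real N + B)"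
          using M[of N] \<open>\<epsilon> > 0\<close> by (intro mult_left_mono) auto
        have "K \<ge> 0" using c0 B0 by (simp add: K_def)
        then have "\<epsilon> * real (M N) < \<epsilon> * real N" using big MN \<open>\<epsilon> > 0\<close> by linarith
        then have "M N < N" using \<open>\<epsilon> > 0\<close> by simp
        then have "\<bar>G (M N)\<bar> \<le> \<epsilon> * real (M N) + D" by (rule less.IH)
        then show ?thesis using step[of N] big MN \<open>\<epsilon> > 0\<close> by linarith
      qed
    qed
    then show ?thesis by blast
  qed
  have "(\<lambda>N. G N / real N) \<longlonglongrightarrow> 0"
  proof (rule LIMSEQ_I)
    fix e :: real assume "e > 0"
    obtain D where D: "\<And>N. \<bar>G N\<bar> \<le> e / 2 * real N + D" using bound[of "e / 2"] \<open>e > 0\<close> by auto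
    obtain n0 :: nat where n0: "2 * D / e < real n0" using reals_Archimedean2 by blast
    show "\<exists>no. \<forall>n\<ge>no. norm (G n / real n - 0) < e"
    proof (intro exI allI impI)
      fix n assume n: "n \<ge> Suc n0"
      then have "2 * D / e < real n" using n0 by linarith
      then have "D < e / 2 * real n" using \<open>e > 0\<close> by (simp add: field_simps)
      then have "\<bar>G n\<bar> < e * real n" using D[of n] by (simp add: field_simps)
      then show "norm (G n / real n - 0) < e" using n by (simp add: field_simps)
    qed
  qed
  then have "(\<lambda>N. G N / real N + c) \<longlonglongrightarrow> 0 + c" by (intro tendsto_intros)
  moreover have "\<forall>\<^sub>F N in sequentially. G N / real N + c = F N / real N"
    using eventually_gt_at_top[of 0] by eventually_elim (simp add: G_def field_simps)
  ultimately show ?thesis unfolding c_def by (simp add: tendsto_cong)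
qed

section \<open>Monotone surjections of the natural numbers\<close>

lemma mono_surj_nat_0:
  fixes f :: "nat \<Rightarrow> nat"
  assumes "mono f" "surj f"
  shows "f 0 = 0"
proof -
  obtain j where "f j = 0" using \<open>surj f\<close> by (metis surjD)
  then show ?thesis using monoD[OF \<open>mono f\<close>, of 0 j] by simp
qed

lemma mono_surj_nat_Suc:
  fixes f :: "nat \<Rightarrow> nat"
  assumes "mono f" "surj f"
  shows "f (Suc n) = f n \<or> f (Suc n) = Suc (f n)"
proof (rule ccontr)
  assume "\<not> ?thesis"
  moreover have "f n \<le> f (Suc n)" using \<open>mono f\<close> by (simp add: monoD)
  ultimately have gap: "f n < Suc (f n)" "Suc (f n) < f (Suc n)" by auto
  obtain j where j: "f j = Suc (f n)" using \<open>surj f\<close> by (metis surjD)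
  have "j \<le> n \<or> Suc n \<le> j" by linarith
  then show False
    using gap j monoD[OF \<open>mono f\<close>, of j n] monoD[OF \<open>mono f\<close>, of "Suc n" j] by linarith
qed

text \<open>
  The map leaves each value exactly once, so summing \<open>c (f j)\<close> over the indices where \<open>f\<close> moves
  is summing \<open>c\<close> over the values left so far.
\<close>

lemma sum_over_jumps:
  fixes f :: "nat \<Rightarrow> nat" and c :: "nat \<Rightarrow> 'b::comm_monoid_add"
  assumes "mono f" "surj f"
  shows "(\<Sum>j<N. if f (Suc j) = f j then 0 else c (f j)) = (\<Sum>i<f N. c i)"
proof (induction N)
  case 0
  show ?case using mono_surj_nat_0[OF assms] by simp
next
  case (Suc N)
  then show ?case using mono_surj_nat_Suc[OF assms, of N] by auto
qed

text \<open>
  A partial sum of fibre sizes counts an initial segment of indices: those sent strictly below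
  \<open>f N\<close> all precede \<open>N\<close>, and those up to \<open>N\<close> are all sent to at most \<open>f N\<close>.
\<close>

lemma sum_card_fibres_bounds:
  fixes f :: "nat \<Rightarrow> nat"
  assumes "mono f" and fin: "\<And>k. finite (f -` {k})"
  shows "(\<Sum>k<f N. card (f -` {k})) \<le> N" "N < (\<Sum>k<Suc (f N). card (f -` {k}))"
proof -
  have S: "(\<Sum>k<n. card (f -` {k})) = card (f -` {..<n})" for n
  proof -
    have "card (\<Union>k\<in>{..<n}. f -` {k}) = (\<Sum>k<n. card (f -` {k}))"
      using fin by (intro card_UN_disjoint) auto
    moreover have "(\<Union>k\<in>{..<n}. f -` {k}) = f -` {..<n}" by auto
    ultimately show ?thesis by simp
  qed
  have "f -` {..<f N} \<subseteq> {..<N}"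
  proof
    fix j assume "j \<in> f -` {..<f N}"
    then have "\<not> f N \<le> f j" by simp
    then show "j \<in> {..<N}" using monoD[OF \<open>mono f\<close>, of N j] by (auto simp: not_le[symmetric])
  qed
  then have "card (f -` {..<f N}) \<le> card {..<N}" by (intro card_mono) auto
  then show "(\<Sum>k<f N. card (f -` {k})) \<le> N" unfolding S by simp
  have "finite (f -` {..<Suc (f N)})"
  proof -
    have "f -` {..<Suc (f N)} = (\<Union>k\<in>{..<Suc (f N)}. f -` {k})" by auto
    then show ?thesis using fin by simp
  qed
  moreover have "{..N} \<subseteq> f -` {..<Suc (f N)}" using monoD[OF \<open>mono f\<close>] by (auto simp: less_Suc_eq_le)
  ultimately have "card {..N} \<le> card (f -` {..<Suc (f N)})" by (rule card_mono)
  then show "N < (\<Sum>k<Suc (f N). card (f -` {k}))" unfolding S by simp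
qed

section \<open>Partial sums of eventually periodic sequences\<close>

lemma eventually_periodic_bounded:
  fixes D :: "nat \<Rightarrow> real"
  assumes "q > 0" and per: "\<And>i. D (m + i + q) = D (m + i)"
  shows "\<exists>B. \<forall>n. \<bar>D n\<bar> \<le> B"
proof -
  define B where "B = Max ((\<lambda>n. \<bar>D n\<bar>) ` {..<m + q})"
  have "\<bar>D n\<bar> \<le> B" for n
  proof (induction n rule: less_induct)
    case (less n)
    show ?case
    proof (cases "n < m + q")
      case True
      then show ?thesis unfolding B_def by (intro Max_ge) auto
    next
      case False
      then have "D n = D (n - q)" using per[of "n - q - m"] by simp
      then show ?thesis using less.IH[of "n - q"] False \<open>q > 0\<close> by simp
    qed
  qed
  then show ?thesis by blast
qed

lemma rhythm_partial_sums:
  assumes "q \<ge> 1" and r: "is_rhythm q p r" and s: "eventually_periodic_with s r"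
  shows "\<exists>B. \<forall>n. \<bar>real (\<Sum>k<n. s k) - real p / real q * real n\<bar> \<le> B"
proof -
  obtain m where m: "\<And>i. s (m + i) = r ! (i mod q)"
    using r s unfolding eventually_periodic_with_def is_rhythm_def by auto
  have "(\<Sum>k<m + i + q. s k) = (\<Sum>k<m + i. s k) + p" for i
  proof (induction i)
    case 0
    have "(\<Sum>k<m + q. s k) = (\<Sum>k<m. s k) + (\<Sum>k<q. s (m + k))"
      by (induction q) auto
    also have "(\<Sum>k<q. s (m + k)) = (\<Sum>k<q. r ! k)" by (intro sum.cong) (simp_all add: m)
    also have "\<dots> = p"
      using r by (auto simp: is_rhythm_def sum_list_sum_nth atLeast0LessThan)
    finally show ?case by simp
  next
    case (Suc i)
    have "s (m + i + q) = s (m + i)" using m[of "i + q"] m[of i] by (simp add: add.assoc)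
    then show ?case using Suc by simp
  qed
  then have "real (\<Sum>k<m + i + q. s k) - real p / real q * real (m + i + q)
      = real (\<Sum>k<m + i. s k) - real p / real q * real (m + i)" for i
    using \<open>q \<ge> 1\<close> by (simp add: field_simps)
  with \<open>q \<ge> 1\<close> show ?thesis
    by (intro eventually_periodic_bounded[where q = q and m = m]) auto
qed

section \<open>Words and their parents\<close>

lemma Delta_self: "\<Delta> u u = 0"
proof -
  have "prefix u (longest_common_prefix u u)" by (rule longest_common_prefix_max_prefix) auto
  then show ?thesis by (simp add: \<Delta>_def prefix_length_le)
qed

lemma longest_common_prefix_snoc:
  "length u = length v \<Longrightarrow> u \<noteq> v
    \<Longrightarrow> longest_common_prefix (u @ [a]) (v @ [b]) = longest_common_prefix u v"
  by (induction u v rule: list_induct2) auto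

lemma longest_common_prefix_snoc_same:
  "a \<noteq> b \<Longrightarrow> longest_common_prefix (u @ [a]) (u @ [b]) = u"
  by (induction u) auto

text \<open>
  For words of equal length, deleting the last letters leaves the common prefix as it is. For
  words of different lengths, \<open>\<Delta>\<close> is the larger length, which drops by one; the parents again have
  different lengths, except for the pair formed by the empty word and a letter, whose parents
  coincide and where \<open>\<Delta>\<close> is \<open>1\<close>.
\<close>

lemma Delta_butlast:
  assumes "u \<noteq> v"
  shows "\<Delta> u v = Suc (\<Delta> (butlast u) (butlast v))"
proof (cases "length u = length v")
  case True
  then have "u \<noteq> []" "v \<noteq> []" using assms by auto
  then obtain u' a v' b where uv: "u = u' @ [a]" "v = v' @ [b]" by (metis rev_exhaust)
  show ?thesis
  proof (cases "u' = v'")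
    case True
    then show ?thesis using uv assms
      by (simp add: Delta_self) (simp add: \<Delta>_def longest_common_prefix_snoc_same)
  next
    case False
    have "length (longest_common_prefix u' v') \<le> length u'"
      by (simp add: longest_common_prefix_prefix1 prefix_length_le)
    then show ?thesis using uv False \<open>length u = length v\<close>
      by (simp add: \<Delta>_def longest_common_prefix_snoc)
  qed
next
  case False
  show ?thesis
  proof (cases "length (butlast u) = length (butlast v)")
    case True
    then have "butlast u = []" "butlast v = []" "max (length u) (length v) = 1"
      using False by (auto simp flip: length_0_conv)
    then show ?thesis using False by (simp add: Delta_self) (simp add: \<Delta>_def)
  next
    case False
    then show ?thesis using \<open>length u \<noteq> length v\<close> by (auto simp: \<Delta>_def)
  qed
qed

text \<open>
  Appending one letter to each of two words, the first smaller than the second, keeps their order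
  whatever the letters are; so the parents cannot be in the opposite order.
\<close>

lemma radix_butlast_mono:
  assumes "(u, v) \<in> radix"
  shows "butlast u = butlast v \<or> (butlast u, butlast v) \<in> radix"
proof (rule ccontr)
  assume "\<not> ?thesis"
  then have r: "(butlast v, butlast u) \<in> radix" using radix_total by blast
  then have "u \<noteq> []" by (auto simp: radix_def)
  have "(v, u) \<in> radix"
  proof (cases "v = []")
    case True
    then show ?thesis using \<open>u \<noteq> []\<close> by (auto simp: radix_def Nil_lenlex_iff1)
  next
    case False
    then have "(butlast v @ [last v], butlast u @ [last u]) \<in> radix"
      using r unfolding radix_def by (intro lenlex_append1) auto
    then show ?thesis using False \<open>u \<noteq> []\<close> by simp
  qed
  then show False using assms radix_irrefl radix_trans by blast
qed

lemma i_children_eq_butlast: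
  assumes "[] \<in> L"
  shows "i_children L w = {v \<in> L. butlast v = w}"
proof -
  have child: "\<exists>a. v = butlast v @ [a]" if "v \<noteq> []" for v :: "'a list"
    using that by (metis append_butlast_last_id)
  show ?thesis
  proof
    show "i_children L w \<subseteq> {v \<in> L. butlast v = w}"
      using assms by (auto simp: i_children_def children_def split: if_splits)
    show "{v \<in> L. butlast v = w} \<subseteq> i_children L w"
    proof
      fix v assume v: "v \<in> {v \<in> L. butlast v = w}"
      show "v \<in> i_children L w"
      proof (cases "v = []")
        case True
        then show ?thesis using v by (auto simp: i_children_def)
      next
        case False
        then obtain a where "v = w @ [a]" using child[of v] v by auto
        then show ?thesis using v by (auto simp: i_children_def children_def)
      qed
    qed
  qed
qed

section \<open>Languages closed under prefixes and extensions\<close>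

lemma pce_butlast_closed: "pce L \<Longrightarrow> w \<in> L \<Longrightarrow> butlast w \<in> L"
  unfolding pce_def by (metis prefixeq_butlast)

lemma pce_Nil: "pce L \<Longrightarrow> L \<noteq> {} \<Longrightarrow> [] \<in> L"
  unfolding pce_def by (metis Nil_prefix ex_in_conv)

lemma pce_child:
  assumes "pce L" "w \<in> L"
  shows "\<exists>v\<in>L. butlast v = w"
proof -
  obtain v where v: "v \<in> L" "strict_prefix w v" using assms unfolding pce_def by blast
  then obtain a z where "v = w @ a # z" by (auto elim: strict_prefixE')
  then have "prefix (w @ [a]) v" by simp
  then have "w @ [a] \<in> L" using assms v unfolding pce_def by blast
  then show ?thesis by force
qed

lemma pce_infinite:
  assumes "pce L" "L \<noteq> {}"
  shows "infinite L"
proof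
  assume fin: "finite L"
  have "Max (length ` L) \<in> length ` L" using fin assms by (intro Max_in) auto
  then obtain w where w: "w \<in> L" "length w = Max (length ` L)" by auto
  then obtain v where v: "v \<in> L" "strict_prefix w v" using assms unfolding pce_def by blast
  then have "length v \<le> length w" using fin w by simp
  then show False using v prefix_length_less by fastforce
qed

lemma radix_enum_props:
  fixes L :: "'a::linorder list set"
  assumes "finite A" "L \<subseteq> lists A" "infinite L"
  shows "range (radix_enum L) = L" "i < j \<Longrightarrow> (radix_enum L i, radix_enum L j) \<in> radix"
  using theI'[OF radix_enum_works[OF assms]] unfolding radix_enum_def by auto

text \<open>
  The parent map, transported to indices by the radix enumeration: it turns the signature into
  fibre sizes and the carry propagation into a recursion.
\<close>

lemma parent_index_exists:
  fixes L :: "'a::linorder list set"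
  assumes "finite A" "L \<subseteq> lists A" "pce L" "L \<noteq> {}"
  obtains f :: "nat \<Rightarrow> nat" where "mono f" "surj f"
    and "\<And>k. finite (f -` {k})" "\<And>k. card (f -` {k}) = signature L k"
    and "\<And>j. cp L j = 1 + (if f (Suc j) = f j then 0 else cp L (f j))"
proof -
  define w where "w = radix_enum L"
  have range_w: "range w = L" and incr: "\<And>i j. i < j \<Longrightarrow> (w i, w j) \<in> radix"
    unfolding w_def using radix_enum_props[OF assms(1,2) pce_infinite[OF assms(3,4)]] by auto
  have inj: "inj w" by (rule injI) (metis incr radix_irrefl linorder_neqE_nat)
  have wL: "w i \<in> L" for i using range_w by blast
  have "\<exists>i. w i = butlast (w j)" for j
    using pce_butlast_closed[OF assms(3) wL[of j]] range_w by (metis imageE)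
  then obtain f where f: "\<And>j. w (f j) = butlast (w j)" by metis
  have mono: "mono f"
  proof (rule monoI, rule ccontr)
    fix i j :: nat assume "i \<le> j" and less: "\<not> f i \<le> f j"
    then have "i < j" using le_neq_implies_less by blast
    then have "w (f i) = w (f j) \<or> (w (f i), w (f j)) \<in> radix"
      unfolding f by (intro radix_butlast_mono incr)
    moreover have "(w (f j), w (f i)) \<in> radix" using less by (intro incr) simp
    ultimately show False using radix_irrefl radix_trans by metis
  qed
  have surj: "surj f"
  proof (rule surjI)
    fix i
    have "\<exists>j. butlast (w j) = w i" using pce_child[OF assms(3) wL[of i]] range_w by (metis imageE)
    then show "f (SOME j. butlast (w j) = w i) = i"
      by (metis (mono_tags, lifting) f inj injD someI_ex)
  qed
  have img: "w ` (f -` {k}) = i_children L (w k)" for k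
  proof -
    have "f j = k \<longleftrightarrow> butlast (w j) = w k" for j using f inj by (metis injD)
    then have "w ` (f -` {k}) = {v \<in> range w. butlast v = w k}" by auto
    then show ?thesis
      using i_children_eq_butlast[OF pce_Nil[OF assms(3,4)]] range_w by simp
  qed
  have card: "card (f -` {k}) = signature L k" for k
    unfolding signature_def w_def[symmetric] img[symmetric]
    by (rule card_image[symmetric]) (rule inj_on_subset[OF inj subset_UNIV])
  have fin: "finite (f -` {k})" for k
  proof -
    obtain j where j: "f j = Suc k" using surj by (metis surjD)
    have "f -` {k} \<subseteq> {..j}"
    proof
      fix i assume "i \<in> f -` {k}"
      then have "\<not> f j \<le> f i" using j by simp
      then show "i \<in> {..j}" using monoD[OF mono, of j i] nat_le_linear[of i j] by auto
    qed
    then show ?thesis by (rule finite_subset) simp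
  qed
  have cp: "cp L j = 1 + (if f (Suc j) = f j then 0 else cp L (f j))" for j
  proof -
    have "w j \<noteq> w (Suc j)" using inj by (metis injD n_not_Suc_n)
    then have "cp L j = Suc (\<Delta> (w (f j)) (w (f (Suc j))))"
      by (simp add: cp_def w_def[symmetric] Delta_butlast f)
    then show ?thesis
      using mono_surj_nat_Suc[OF mono surj, of j]
      by (auto simp: Delta_self cp_def w_def[symmetric])
  qed
  show thesis by (rule that[OF mono surj fin card cp])
qed

theorem theorem3p23:
  fixes p q :: nat and A :: "'a::linorder set" and L :: "'a list set" and r :: "nat list"
  assumes "p > q" and "q \<ge> 1"
    and "finite A" and "L \<subseteq> lists A"
    and "pce L" and "L \<noteq> {}"
    and "is_rhythm q p r" and "eventually_periodic_with (signature L) r"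
  shows "convergent (cp_mean L) \<and> CP L = real p / (real p - real q)"
proof -
  obtain f :: "nat \<Rightarrow> nat" where f: "mono f" "surj f"
    and fin: "\<And>k. finite (f -` {k})" and card: "\<And>k. card (f -` {k}) = signature L k"
    and cp: "\<And>j. cp L j = 1 + (if f (Suc j) = f j then 0 else cp L (f j))"
    using parent_index_exists[OF assms(3-6)] by metis
  define F where "F N = (\<Sum>j<N. real (cp L j))" for N
  define \<alpha> where "\<alpha> = real q / real p"
  have F: "F N = real N + F (f N)" for N
  proof -
    have "F N = (\<Sum>j<N. 1 + (if f (Suc j) = f j then 0 else real (cp L (f j))))"
      unfolding F_def by (intro sum.cong refl) (subst cp, simp)
    then show ?thesis
      using sum_over_jumps[OF f, of "\<lambda>i. real (cp L i)" N] by (simp add: sum.distrib F_def)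
  qed
  obtain B where B: "\<And>n. \<bar>real (\<Sum>k<n. signature L k) - real p / real q * real n\<bar> \<le> B"
    using rhythm_partial_sums[OF assms(2,7,8)] by blast
  have approx: "\<bar>real (f N) - \<alpha> * real N\<bar> \<le> \<alpha> * B + 1" for N
  proof -
    have "real (\<Sum>k<f N. signature L k) \<le> real N" "real N \<le> real (\<Sum>k<Suc (f N). signature L k)"
      using sum_card_fibres_bounds[OF f(1) fin, of N] unfolding card of_nat_le_iff by auto
    then have "real p / real q * real (f N) \<le> real N + B"
      "real N - B \<le> real p / real q * (real (f N) + 1)"
      using B[of "f N"] B[of "Suc (f N)"] by (simp_all add: abs_le_iff add.commute)
    then have "\<alpha> * (real p / real q * real (f N)) \<le> \<alpha> * (real N + B)"
      "\<alpha> * (real N - B) \<le> \<alpha> * (real p / real q * (real (f N) + 1))"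
      by (auto simp only: \<alpha>_def intro!: mult_left_mono divide_nonneg_nonneg of_nat_0_le_iff)
    moreover have "\<alpha> * (real p / real q * x) = x" for x
      using assms(1,2) by (simp add: \<alpha>_def)
    ultimately have "real (f N) \<le> \<alpha> * (real N + B)" "\<alpha> * (real N - B) \<le> real (f N) + 1"
      by metis+
    then show ?thesis by (simp add: abs_le_iff algebra_simps)
  qed
  have "(\<lambda>N. F N / real N) \<longlonglongrightarrow> 1 / (1 - \<alpha>)"
    using assms(1) by (intro contracting_recursion_limit[OF _ _ approx F]) (auto simp: \<alpha>_def)
  moreover have "1 / (1 - \<alpha>) = real p / (real p - real q)"
    using assms(1) by (simp add: \<alpha>_def field_simps)
  moreover have "cp_mean L = (\<lambda>N. F N / real N)" by (auto simp: cp_mean_def F_def)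
  ultimately have "cp_mean L \<longlonglongrightarrow> real p / (real p - real q)" by simp
  then show ?thesis unfolding CP_def by (auto intro: convergentI limI)
qed

end
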